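(* Let $G$ be an elementary abelian $2$-group of rank $n$, and suppose that there exists a $\{1,-1\}$-matrix $M=(M_{x,y})_{x,y\in G}$ with rows and columns indexed by $G$ such that for any $x,y,z\in G$ with $x\neq y$, \[ M_{x,xz}\,M_{x,yz}\,M_{y,xz}\,M_{y,yz}=-1 .\] Then the order of the matrix $M$ (which equals $|G|=2^n$) is limited to $2$, $4$ or $8$.
   Context: An elementary abelian $2$-group of rank $n$ is a group (written multiplicatively here) isomorphic to $(\mathbb{Z}/2\mathbb{Z})^n$. A $\{1,-1\}$-matrix is a matrix all of whose entries are $1$ or $-1$. The order of a square matrix is its number of rows.
   Formalization: The rank n is assumed to be at least 1; for n = 0 the group is trivial, the condition on M is vacuous, and M = (1) has order 1, so the claim fails there. *)

theory Defs
  imports "HOL-Algebra.Algebra"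
begin

definition elementary_abelian_2_group :: "('g, 'm) monoid_scheme \<Rightarrow> nat \<Rightarrow> bool" where
  "elementary_abelian_2_group G n \<longleftrightarrow>
     group G \<and> G \<cong> product_group {..<n} (\<lambda>_. integer_mod_group 2)"

text \<open>
  A matrix with rows and columns indexed by a set \<open>I\<close> is a function
  \<open>M :: 'i \<Rightarrow> 'i \<Rightarrow> int\<close>, of which only the values on \<open>I \<times> I\<close> matter;
  its order (number of rows) is \<open>card I\<close>, hence \<open>order G\<close> for \<open>I = carrier G\<close>.
\<close>

definition pm1_matrix_on :: "'i set \<Rightarrow> ('i \<Rightarrow> 'i \<Rightarrow> int) \<Rightarrow> bool" where
  "pm1_matrix_on I M \<longleftrightarrow> (\<forall>x\<in>I. \<forall>y\<in>I. M x y \<in> {1, -1})"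

end

theory Submission
  imports Defs
begin

text \<open>
  On the space of real functions on the group, with basis \<open>e u\<close>, consider the monomial operators
  \<open>A x (e u) = M x u \<cdot> e (x u)\<close>.  The hypothesis on \<open>M\<close> says that \<open>(A x)\<^sup>T A y\<close> is
  skew-symmetric whenever \<open>x \<noteq> y\<close>, so the matrix is a composition of sums of squares in disguise
  and the bound is of Hurwitz type.  As in the proof of Hurwitz's theorem, the operators
  \<open>B x = (A \<one>)\<^sup>T A x\<close> with \<open>x \<noteq> \<one>\<close> anticommute pairwise (\<open>normalized_signs_anticommute\<close>);
  they are again monomial, \<open>B x (e u) = s x u \<cdot> e (x u)\<close> with signs \<open>s x u\<close>.

  Because the \<open>B x\<close> permute the basis by group translations, no representation theory is needed.
  If \<open>a, b, c, d\<close> are independent, then \<open>D = B (a b) B b B a\<close> and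
  \<open>E = B (c d) B d B c\<close> are diagonal, hence commute.  But \<open>D\<close> is a product of three operators,
  each anticommuting with each of the three factors of \<open>E\<close>; moving \<open>E\<close> past \<open>D\<close> therefore
  costs the sign \<open>(-1)^9\<close>, which is a contradiction (\<open>anticommuting_signs_order_le_8\<close>).
  So the group has no four independent elements.
\<close>

lemma (in group) involutive_comm:
  assumes sq: "\<And>x. x \<in> carrier G \<Longrightarrow> x \<otimes> x = \<one>"
    and x: "x \<in> carrier G" and y: "y \<in> carrier G"
  shows "x \<otimes> y = y \<otimes> x"
proof -
  have "inv z = z" if "z \<in> carrier G" for z
    using sq[OF that] that inv_equality by blast
  then show ?thesis
    using inv_mult_group[OF x y] x y by simp
qed

lemma elementary_abelian_2_group_square:
  fixes G (structure)
  assumes "elementary_abelian_2_group G n" and x: "x \<in> carrier G"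
  shows "x \<otimes> x = \<one>"
proof -
  let ?P = "product_group {..<n} (\<lambda>_. integer_mod_group 2)"
  interpret group G
    using assms by (simp add: elementary_abelian_2_group_def)
  interpret P: group ?P
    by simp
  obtain h where h: "h \<in> iso G ?P"
    using assms by (auto simp: elementary_abelian_2_group_def is_iso_def)
  then have hom: "h \<in> hom G ?P" and inj: "inj_on h (carrier G)"
    by (auto simp: iso_def bij_betw_def)
  have "h x \<otimes>\<^bsub>?P\<^esub> h x = \<one>\<^bsub>?P\<^esub>"
    by (simp add: mult_product_group one_product_group integer_mod_group_def
        restrict_def fun_eq_iff integer_group_def)
  then have "h (x \<otimes> x) = h \<one>"
    using hom x hom_mult[OF hom x x] hom_one[OF hom is_group P.is_group] by simp
  then show ?thesis
    using inj x by (auto dest: inj_onD)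
qed

lemma elementary_abelian_2_group_order:
  assumes "elementary_abelian_2_group G n"
  shows "order G = 2 ^ n"
proof -
  have "order G = order (product_group {..<n} (\<lambda>_. integer_mod_group 2))"
    unfolding order_def using assms by (intro iso_same_card) (simp add: elementary_abelian_2_group_def)
  also have "\<dots> = 2 ^ n"
    by (simp add: order_def carrier_product_group card_PiE carrier_integer_mod_group)
  finally show ?thesis .
qed

text \<open>
  The product in the conclusion compares the coefficients of \<open>B x B y\<close> and \<open>B y B x\<close> at
  \<open>e u\<close>.  Skew-symmetry of \<open>B x\<close> turns \<open>B x B y = (A \<one>)\<^sup>T A x (A \<one>)\<^sup>T A y\<close> into
  \<open>- (A x)\<^sup>T A y\<close>, and the hypothesis for the pair \<open>x, y\<close> says that this changes sign when
  \<open>x\<close> and \<open>y\<close> are exchanged.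
\<close>

lemma (in group) normalized_signs_anticommute:
  fixes M :: "'a \<Rightarrow> 'a \<Rightarrow> int"
  defines "s \<equiv> \<lambda>x u. M x u * M \<one> (x \<otimes> u)"
  assumes sq: "\<And>x. x \<in> carrier G \<Longrightarrow> x \<otimes> x = \<one>"
    and pm: "pm1_matrix_on (carrier G) M"
    and alt: "\<And>x y z. \<lbrakk>x \<in> carrier G; y \<in> carrier G; z \<in> carrier G; x \<noteq> y\<rbrakk> \<Longrightarrow>
           M x (x \<otimes> z) * M x (y \<otimes> z) * M y (x \<otimes> z) * M y (y \<otimes> z) = -1"
    and x: "x \<in> carrier G" "x \<noteq> \<one>" and y: "y \<in> carrier G" "y \<noteq> \<one>" and "x \<noteq> y"
    and u: "u \<in> carrier G"
  shows "s x (y \<otimes> u) * s y u * (s y (x \<otimes> u) * s x u) = -1"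
proof -
  have comm: "v \<otimes> w = w \<otimes> v" if "v \<in> carrier G" "w \<in> carrier G" for v w
    using involutive_comm[OF sq] that by blast
  have pm': "M v w = 1 \<or> M v w = -1" if "v \<in> carrier G" "w \<in> carrier G" for v w
    using pm that by (auto simp: pm1_matrix_on_def)
  define w where "w = x \<otimes> (y \<otimes> u)"
  have w: "w \<in> carrier G" "y \<otimes> (x \<otimes> u) = w"
    using x y u comm[of x y] by (auto simp: w_def m_assoc[symmetric])
  have xw: "x \<otimes> w = y \<otimes> u" and yw: "y \<otimes> w = x \<otimes> u"
    using x y u sq w by (auto simp: w_def m_assoc[symmetric])
       (metis (no_types, lifting) l_one m_assoc m_closed)
  have swap: "s v t * (M \<one> t * M v (v \<otimes> t)) = -1"
    if "v \<in> carrier G" "v \<noteq> \<one>" "t \<in> carrier G" for v t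
    using alt[of \<one> v t] that by (simp add: s_def algebra_simps)
  have 1: "s x (y \<otimes> u) * (M \<one> (y \<otimes> u) * M x w) = -1"
    using swap[of x "y \<otimes> u"] x y u by (simp add: w_def)
  have 2: "s y (x \<otimes> u) * (M \<one> (x \<otimes> u) * M y w) = -1"
    using swap[of y "x \<otimes> u"] x y u w by simp
  have 3: "M x u * M x w * M y u * M y w = -1"
  proof -
    have "x \<otimes> (x \<otimes> u) = u" "y \<otimes> (x \<otimes> u) = w"
      using x u sq w by (auto simp: m_assoc[symmetric])
    then show ?thesis
      using alt[of x y "x \<otimes> u"] x y u \<open>x \<noteq> y\<close> by simp
  qed
  have "s y u = M y u * M \<one> (y \<otimes> u)" "s x u = M x u * M \<one> (x \<otimes> u)"
    by (auto simp: s_def)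
  then show ?thesis
    using 1 2 3 pm'[of \<one> "y \<otimes> u"] pm'[of \<one> "x \<otimes> u"] pm'[of x u] pm'[of x w] pm'[of y u] pm'[of y w]
      x y u w by auto
qed

text \<open>
  The function \<open>D\<close> in the proof lists the diagonal entries of \<open>B (a b) B b B a\<close>.
  Anticommutation of \<open>B y\<close> with this threefold product says \<open>D (y u) = - D u\<close>, for each
  \<open>y\<close> among \<open>c, d, c d\<close>; since the product of these three elements is \<open>\<one>\<close>, following them
  in turn returns to the starting point with the sign reversed.
\<close>

lemma (in group) anticommuting_signs_order_le_8:
  fixes s :: "'a \<Rightarrow> 'a \<Rightarrow> int"
  assumes sq: "\<And>x. x \<in> carrier G \<Longrightarrow> x \<otimes> x = \<one>"
    and sign: "\<And>x u. \<lbrakk>x \<in> carrier G; u \<in> carrier G\<rbrakk> \<Longrightarrow> s x u \<in> {1, -1}"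
    and anti: "\<And>x y u. \<lbrakk>x \<in> carrier G; y \<in> carrier G; u \<in> carrier G; x \<noteq> \<one>; y \<noteq> \<one>; x \<noteq> y\<rbrakk>
           \<Longrightarrow> s x (y \<otimes> u) * s y u * (s y (x \<otimes> u) * s x u) = -1"
  shows "order G \<le> 8"
proof (rule ccontr)
  assume "\<not> order G \<le> 8"
  then have big: "\<exists>x\<in>carrier G. x \<notin> set xs" if "length xs \<le> 8" for xs
    using that card_mono[of "set xs" "carrier G"] card_length[of xs]
    by (fastforce simp: order_def)
  have comm: "v \<otimes> w = w \<otimes> v" if "v \<in> carrier G" "w \<in> carrier G" for v w
    using involutive_comm[OF sq] that by blast
  have cancel: "v \<otimes> (v \<otimes> w) = w" if "v \<in> carrier G" "w \<in> carrier G" for v w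
    using sq that by (simp add: m_assoc[symmetric])
  obtain a where a: "a \<in> carrier G" "a \<noteq> \<one>"
    using big[of "[\<one>]"] by auto
  obtain b where b: "b \<in> carrier G" "b \<noteq> \<one>" "b \<noteq> a"
    using big[of "[\<one>, a]"] by auto
  define H where "H = [\<one>, a, b, a \<otimes> b]"
  have HG: "set H \<subseteq> carrier G"
    using a b by (auto simp: H_def)
  obtain c where c: "c \<in> carrier G" "c \<notin> set H"
    using big[of H] by (auto simp: H_def)
  obtain d where d: "d \<in> carrier G" "d \<notin> set H" "d \<notin> set (map ((\<otimes>) c) H)"
    using big[of "H @ map ((\<otimes>) c) H"] by (auto simp: H_def)
  have cd: "c \<otimes> d \<notin> set H"
  proof
    assume "c \<otimes> d \<in> set H"
    then have "c \<otimes> (c \<otimes> d) \<in> set (map ((\<otimes>) c) H)"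
      by simp
    then show False
      using d c cancel[of c d] by simp
  qed
  define K where "K = {a, b, a \<otimes> b}"
  have "a \<otimes> b \<noteq> \<one>"
    using a b cancel[of a b] by auto
  then have K: "x \<in> carrier G \<and> x \<noteq> \<one> \<and> x \<in> set H" if "x \<in> K" for x
    using that a b by (auto simp: K_def H_def)
  define D where "D u = s a u * s b (a \<otimes> u) * s (a \<otimes> b) (b \<otimes> (a \<otimes> u))" for u
  have flip: "D (y \<otimes> u) = - D u"
    if y: "y \<in> carrier G" "y \<notin> set H" and u: "u \<in> carrier G" for y u
  proof -
    have step: "s x (y \<otimes> v) * s y v * (s y (x \<otimes> v) * s x v) = -1"
      if "x \<in> K" "v \<in> carrier G" for x v
      using anti[of x y v] K[OF that(1)] that y by (auto simp: H_def)
    have shift: "x \<otimes> (y \<otimes> v) = y \<otimes> (x \<otimes> v)" if "x \<in> carrier G" "v \<in> carrier G" for x v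
      using that y comm[of x y] by (simp add: m_assoc[symmetric])
    have close: "(a \<otimes> b) \<otimes> (b \<otimes> (a \<otimes> u)) = u"
      using a b u cancel by (simp add: m_assoc)
    define v1 where "v1 = a \<otimes> u"
    define v2 where "v2 = b \<otimes> v1"
    have v: "v1 \<in> carrier G" "v2 \<in> carrier G"
      using a b u by (auto simp: v1_def v2_def)
    have eqs: "s a (y \<otimes> u) * s y u * (s y v1 * s a u) = -1"
      "s b (y \<otimes> v1) * s y v1 * (s y v2 * s b v1) = -1"
      "s (a \<otimes> b) (y \<otimes> v2) * s y v2 * (s y u * s (a \<otimes> b) v2) = -1"
      using step[of a u] step[of b v1] step[of "a \<otimes> b" v2] u v close
      by (simp_all add: K_def v1_def v2_def)
    have D1: "D u = s a u * s b v1 * s (a \<otimes> b) v2"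
      by (simp add: D_def v1_def v2_def)
    have D2: "D (y \<otimes> u) = s a (y \<otimes> u) * s b (y \<otimes> v1) * s (a \<otimes> b) (y \<otimes> v2)"
      using a b u y v by (simp add: D_def shift v1_def v2_def)
    have signs: "s y u \<in> {1, -1}" "s y v1 \<in> {1, -1}" "s y v2 \<in> {1, -1}"
      "s a u \<in> {1, -1}" "s b v1 \<in> {1, -1}" "s (a \<otimes> b) v2 \<in> {1, -1}"
      using sign a b y u v by auto
    show ?thesis
      unfolding D1 D2 using eqs signs by auto
  qed
  have "D ((c \<otimes> d) \<otimes> (d \<otimes> (c \<otimes> \<one>))) = - D \<one>"
    using flip[of c \<one>] flip[of d "c \<otimes> \<one>"] flip[of "c \<otimes> d" "d \<otimes> (c \<otimes> \<one>)"] c d cd by simp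
  moreover have "(c \<otimes> d) \<otimes> (d \<otimes> (c \<otimes> \<one>)) = \<one>"
    using c d cancel sq by (simp add: m_assoc)
  ultimately have "D \<one> = 0"
    by simp
  moreover have "D \<one> \<noteq> 0"
    using sign[of a \<one>] sign[of b a] sign[of "a \<otimes> b" "b \<otimes> a"] a b by (auto simp: D_def)
  ultimately show False
    by simp
qed

theorem mainTheorem2:
  fixes G :: "('g, 'm) monoid_scheme" (structure)
    and n :: nat
    and M :: "'g \<Rightarrow> 'g \<Rightarrow> int"
  assumes "n \<ge> 1"
    and "elementary_abelian_2_group G n"
    and "pm1_matrix_on (carrier G) M"
    and "\<And>x y z. \<lbrakk>x \<in> carrier G; y \<in> carrier G; z \<in> carrier G; x \<noteq> y\<rbrakk> \<Longrightarrow>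
           M x (x \<otimes> z) * M x (y \<otimes> z) * M y (x \<otimes> z) * M y (y \<otimes> z) = -1"
  shows "order G = 2 ^ n \<and> order G \<in> {2, 4, 8}"
proof -
  interpret group G
    using assms(2) by (simp add: elementary_abelian_2_group_def)
  note sq = elementary_abelian_2_group_square[OF assms(2)]
  have ord: "order G = 2 ^ n"
    by (rule elementary_abelian_2_group_order[OF assms(2)])
  have "order G \<le> 8"
  proof (rule anticommuting_signs_order_le_8[OF sq, where s = "\<lambda>x u. M x u * M \<one> (x \<otimes> u)"])
    show "M x u * M \<one> (x \<otimes> u) \<in> {1, -1}" if "x \<in> carrier G" "u \<in> carrier G" for x u
    proof -
      have "M x u \<in> {1, -1}" "M \<one> (x \<otimes> u) \<in> {1, -1}"
        using assms(3) that by (auto simp: pm1_matrix_on_def)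
      then show ?thesis
        by auto
    qed
  qed (assumption, rule normalized_signs_anticommute[OF sq assms(3,4)])
  then have "(2::nat) ^ n \<le> 2 ^ 3"
    using ord by simp
  then have "n \<le> 3"
    by (subst (asm) power_increasing_iff) auto
  then have "n = 1 \<or> n = 2 \<or> n = 3"
    using \<open>n \<ge> 1\<close> by auto
  then show ?thesis
    using ord by auto
qed

end
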